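(* Fix $\theta_1,\theta_2\in\Theta$. Suppose that the kernel $K_\lambda(t)=\partial_\lambda\log w_{\lambda,\theta}(t)$ does not depend on $\theta$ and is nondecreasing (resp. nonincreasing) in $t\in J$. If, for every $\lambda\in\Lambda$, $P_{\theta_2}$ is smaller than $P_{\theta_1}$ in the usual stochastic order, then the quotient $$\lambda\longmapsto\frac{\Phi(\lambda,\theta_1)}{\Phi(\lambda,\theta_2)}$$ is nondecreasing (resp. nonincreasing) on $\Lambda$.
   Context: Setting. $\Lambda\subseteq\mathbb R$ is an interval, $\Theta\subseteq\mathbb R$ is a set of parameters, and $J$ is either an interval of $\mathbb R$, equipped with Lebesgue measure $\mu$, or a subset of $\mathbb N_0=\{0,1,2,\dots\}$, equipped with counting measure $\mu$. For $(\lambda,\theta)\in\Lambda\times\Theta$, $w_{\lambda,\theta}:J\to(0,\infty)$ is a (measurable) positive weight function, and $\Phi(\lambda,\theta)=\int_J w_{\lambda,\theta}(t)\,d\mu(t)$ is assumed finite and positive. For each $\lambda$, $P_\theta$ is the probability law on $J$ with density $w_{\lambda,\theta}/\Phi(\lambda,\theta)$ with respect to $\mu$ (it depends on $\lambda$ too). Regularity in $\lambda$ (standing assumption). For each $\theta\in\Theta$ and $t\in J$ the map $\lambda\mapsto\log w_{\lambda,\theta}(t)$ is $C^1$ on $\Lambda$, and for every compact interval $B\subseteq\Lambda$ there is $m_B\in L^1(J,\mu)$ with $\sup_{\lambda\in B}|\partial_\lambda w_{\lambda,\theta}(t)|\le m_B(t)$ for $\mu$-a.e. $t\in J$. Usual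 stochastic order: $P$ is smaller than $Q$ if $P([t,\infty)\cap J)\le Q([t,\infty)\cap J)$ for all $t\in J$; equivalently $\mathbb E\,h(X)\le\mathbb E\,h(Y)$, $X\sim P$, $Y\sim Q$, for every nondecreasing $h$ for which both expectations exist. *)

theory Defs
  imports "HOL-Analysis.Analysis"
begin

text \<open>
  A weight family is given by \<open>w x \<theta> t\<close>, where only arguments \<open>x \<in> \<Lambda>\<close>, \<open>\<theta> \<in> \<Theta>\<close>, \<open>t \<in> J\<close> matter.
  Here \<open>x\<close> is the first parameter, usually called lambda. All derivatives in \<open>x\<close> are taken relative to the interval \<open>\<Lambda>\<close>, so that they are one-sided
  at those endpoints that belong to \<open>\<Lambda>\<close>.
\<close>

definition log_kernel :: "real set \<Rightarrow> (real \<Rightarrow> real \<Rightarrow> real \<Rightarrow> real) \<Rightarrow> real \<Rightarrow> real \<Rightarrow> real \<Rightarrow> real"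
  where "log_kernel \<Lambda> w \<theta> x t = vector_derivative (\<lambda>l. ln (w l \<theta> t)) (at x within \<Lambda>)"

definition weight_deriv :: "real set \<Rightarrow> (real \<Rightarrow> real \<Rightarrow> real \<Rightarrow> real) \<Rightarrow> real \<Rightarrow> real \<Rightarrow> real \<Rightarrow> real"
  where "weight_deriv \<Lambda> w \<theta> x t = vector_derivative (\<lambda>l. w l \<theta> t) (at x within \<Lambda>)"

definition Phi :: "real measure \<Rightarrow> (real \<Rightarrow> real \<Rightarrow> real \<Rightarrow> real) \<Rightarrow> real \<Rightarrow> real \<Rightarrow> real"
  where "Phi \<mu> w x \<theta> = (LINT t|\<mu>. w x \<theta> t)"

definition law :: "real measure \<Rightarrow> (real \<Rightarrow> real \<Rightarrow> real \<Rightarrow> real) \<Rightarrow> real \<Rightarrow> real \<Rightarrow> real measure"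
  where "law \<mu> w x \<theta> = density \<mu> (\<lambda>t. ennreal (w x \<theta> t / Phi \<mu> w x \<theta>))"

definition stoch_le :: "real set \<Rightarrow> real measure \<Rightarrow> real measure \<Rightarrow> bool"
  where "stoch_le J P Q \<longleftrightarrow> (\<forall>t\<in>J. measure P ({t..} \<inter> J) \<le> measure Q ({t..} \<inter> J))"

text \<open>
  In the discrete case \<open>J\<close> is a set of reals contained in the image of the natural numbers.
  The dominating function \<open>m\<close> may depend on \<open>\<theta>\<close> as well as on the compact interval.
\<close>

locale weight_family =
  fixes \<Lambda> \<Theta> J :: "real set"
    and \<mu> :: "real measure"
    and w :: "real \<Rightarrow> real \<Rightarrow> real \<Rightarrow> real"
  assumes interval: "is_interval \<Lambda>"
    and base: "is_interval J \<and> \<mu> = lebesgue_on J \<or> J \<subseteq> \<nat> \<and> \<mu> = count_space J"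
    and measurable: "\<lbrakk>x \<in> \<Lambda>; \<theta> \<in> \<Theta>\<rbrakk> \<Longrightarrow> w x \<theta> \<in> borel_measurable \<mu>"
    and positive: "\<lbrakk>x \<in> \<Lambda>; \<theta> \<in> \<Theta>; t \<in> J\<rbrakk> \<Longrightarrow> 0 < w x \<theta> t"
    and Phi_finite: "\<lbrakk>x \<in> \<Lambda>; \<theta> \<in> \<Theta>\<rbrakk> \<Longrightarrow> integrable \<mu> (w x \<theta>)"
    and Phi_positive: "\<lbrakk>x \<in> \<Lambda>; \<theta> \<in> \<Theta>\<rbrakk> \<Longrightarrow> 0 < Phi \<mu> w x \<theta>"
    and log_differentiable:
      "\<lbrakk>x \<in> \<Lambda>; \<theta> \<in> \<Theta>; t \<in> J\<rbrakk> \<Longrightarrow> (\<lambda>l. ln (w l \<theta> t)) differentiable (at x within \<Lambda>)"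
    and log_deriv_continuous:
      "\<lbrakk>\<theta> \<in> \<Theta>; t \<in> J\<rbrakk> \<Longrightarrow> continuous_on \<Lambda> (\<lambda>x. log_kernel \<Lambda> w \<theta> x t)"
    and dominated:
      "\<lbrakk>\<theta> \<in> \<Theta>; a \<le> b; {a..b} \<subseteq> \<Lambda>\<rbrakk> \<Longrightarrow>
        \<exists>m. integrable \<mu> m \<and> (AE t in \<mu>. \<forall>x\<in>{a..b}. \<bar>weight_deriv \<Lambda> w \<theta> x t\<bar> \<le> m t)"

end

theory Submission
  imports Defs
begin

text \<open>
  The idea is to compare two parameter values \<open>x\<close>, \<open>y\<close> of \<open>\<Lambda>\<close> directly, through the ratio
  \<open>g t = w y \<theta> t / w x \<theta> t\<close> of the weights. Since \<open>ln w\<close> has the same \<open>\<lambda>\<close>-derivative \<open>K\<close> for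
  \<open>\<theta>1\<close> and \<open>\<theta>2\<close>, the function \<open>g\<close> is the same for both. Moreover \<open>Phi y \<theta> / Phi x \<theta>\<close> is the
  expectation of \<open>g\<close> under the law with parameters \<open>x\<close>, \<open>\<theta>\<close> (\<open>nn_integral_law_ratio\<close>), so that the
  quotient of the theorem is governed by expectations of one function under two laws.

  Monotonicity of \<open>K\<close> in \<open>t\<close> passes to \<open>ln g\<close>, because \<open>ln g t - ln g s\<close> is the increment over
  \<open>\<lambda>\<close> of a function with derivative \<open>K \<lambda> t - K \<lambda> s\<close> (\<open>log_increment_le\<close>). So if \<open>K\<close> is
  nondecreasing and \<open>x \<le> y\<close>, the stochastic order at \<open>x\<close> gives
  \<open>Phi y \<theta>2 / Phi x \<theta>2 \<le> Phi y \<theta>1 / Phi x \<theta>1\<close>, which is the claim. If \<open>K\<close> is nonincreasing, the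
  ratio is nondecreasing in \<open>t\<close> when the step is taken backwards from \<open>y\<close> to \<open>x\<close>, and the same
  argument, based at \<open>y\<close>, gives the reversed inequality; hence a single lemma
  (\<open>Phi_quotient_le\<close>) serves both cases.

  The stochastic order is given on half-lines with end point in \<open>J\<close> only. It extends to all
  upward closed subsets of \<open>J\<close> by continuity of measures from below
  (\<open>emeasure_up_closed_le\<close>), and from these to expectations of nonnegative nondecreasing functions
  by the layer-cake formula.
\<close>

section \<open>Expectations under the usual stochastic order\<close>

text \<open>
  A dense sequence alone need not suffice, as it may miss a least element; but if there is a
  least element, that point alone is enough.
\<close>

lemma countable_coinitial_subset:
  fixes U :: "real set"
  assumes "U \<noteq> {}"
  obtains D where "countable D" "D \<noteq> {}" "D \<subseteq> U" "\<And>u. u \<in> U \<Longrightarrow> \<exists>d\<in>D. d \<le> u"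
proof (cases "\<exists>m\<in>U. \<forall>u\<in>U. m \<le> u")
  case True
  then obtain m where "m \<in> U" "\<forall>u\<in>U. m \<le> u" by blast
  then show thesis by (intro that[of "{m}"]) auto
next
  case False
  obtain D where D: "countable D" "D \<subseteq> U" "U \<subseteq> closure D"
    by (rule separable)
  have "\<exists>d\<in>D. d \<le> u" if "u \<in> U" for u
  proof -
    have "\<exists>s\<in>U. s < u"
      using False that by (simp add: not_le)
    then obtain s where s: "s \<in> U" "s < u" by blast
    then have "s \<in> closure D" "0 < u - s" using D(3) by auto
    then obtain d where "d \<in> D" "dist d s < u - s"
      unfolding closure_approachable by blast
    then show ?thesis by (auto simp: dist_real_def intro!: bexI[of _ d])
  qed
  moreover from this assms have "D \<noteq> {}" by blast
  ultimately show thesis using that D by blast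
qed

text \<open>
  A nonempty upward closed subset of \<open>J\<close> is the union of an increasing sequence of half-lines in \<open>J\<close>
  with end points in \<open>J\<close>, even when its infimum is not attained or is infinite.
\<close>

lemma emeasure_up_closed_le:
  fixes P Q :: "real measure"
  assumes le: "\<And>t. t \<in> J \<Longrightarrow> emeasure P ({t..} \<inter> J) \<le> emeasure Q ({t..} \<inter> J)"
    and meas: "\<And>t. t \<in> J \<Longrightarrow> {t..} \<inter> J \<in> sets P" "sets Q = sets P"
    and U: "U \<subseteq> J" "\<And>s t. s \<in> U \<Longrightarrow> t \<in> J \<Longrightarrow> s \<le> t \<Longrightarrow> t \<in> U"
  shows "emeasure P U \<le> emeasure Q U"
proof (cases "U = {}")
  case False
  then obtain D where D: "countable D" "D \<noteq> {}" "D \<subseteq> U" "\<And>u. u \<in> U \<Longrightarrow> \<exists>d\<in>D. d \<le> u"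
    using countable_coinitial_subset by blast
  define e where "e n = Min (from_nat_into D ` {..n})" for n
  have e_in: "e n \<in> U" for n
  proof -
    have "e n \<in> from_nat_into D ` {..n}" unfolding e_def by (intro Min_in) auto
    then obtain k where "e n = from_nat_into D k" by blast
    then show ?thesis using D(3) from_nat_into[OF D(2), of k] by auto
  qed
  have e_le: "e n \<le> e m" if "m \<le> n" for m n
    unfolding e_def using that by (intro Min_antimono) auto
  define A where "A n = {e n..} \<inter> J" for n
  have A_sets: "A n \<in> sets P" for n using meas e_in U(1) unfolding A_def by blast
  have "incseq A" unfolding A_def incseq_def using e_le by (auto intro: order_trans)
  have "U \<subseteq> (\<Union>n. A n)"
  proof
    fix u assume u: "u \<in> U"
    then obtain d where d: "d \<in> D" "d \<le> u" using D(4) by blast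
    then obtain n where n: "from_nat_into D n = d"
      using D(1) from_nat_into_surj by metis
    have "e n \<le> d" unfolding e_def using n by (intro Min_le) auto
    then have "u \<in> A n" using d u U(1) unfolding A_def by auto
    then show "u \<in> (\<Union>n. A n)" by blast
  qed
  moreover have "(\<Union>n. A n) \<subseteq> U" using e_in U(2) unfolding A_def by auto
  ultimately have U_eq: "U = (\<Union>n. A n)" by (rule subset_antisym)
  have "emeasure P U = (SUP n. emeasure P (A n))"
    unfolding U_eq using A_sets \<open>incseq A\<close> by (intro SUP_emeasure_incseq[symmetric]) auto
  also have "\<dots> \<le> (SUP n. emeasure Q (A n))"
    using le e_in U(1) unfolding A_def by (intro SUP_mono) blast
  also have "\<dots> = emeasure Q U"
    unfolding U_eq using A_sets meas(2) \<open>incseq A\<close> by (intro SUP_emeasure_incseq) auto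
  finally show ?thesis .
qed simp

text \<open>
  Fubini's theorem for the region below the graph of \<open>g\<close>. The indicator matches the coercion to
  \<open>ennreal\<close>, which cuts off negative values of \<open>g\<close>.
\<close>

lemma nn_integral_layer_cake:
  fixes g :: "'a \<Rightarrow> real"
  assumes "sigma_finite_measure M" and [measurable]: "g \<in> borel_measurable M"
  shows "(\<integral>\<^sup>+t. ennreal (g t) \<partial>M) =
         (\<integral>\<^sup>+u. indicator {0..} u * emeasure M {t \<in> space M. u < g t} \<partial>lborel)"
proof -
  interpret M: sigma_finite_measure M by fact
  interpret pair_sigma_finite M "lborel :: real measure" ..
  define S where "S t u = (indicator {0..} u * indicator {u. u < g t} u :: ennreal)" for t u
  have [measurable]: "(\<lambda>(t, u). S t u) \<in> borel_measurable (M \<Otimes>\<^sub>M lborel)"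
    unfolding S_def indicator_def by measurable
  have "ennreal (g t) = (\<integral>\<^sup>+u. S t u \<partial>lborel)" for t
  proof -
    have "S t = indicator {0..<g t}" by (auto simp: S_def fun_eq_iff indicator_def)
    then show ?thesis by (cases "0 \<le> g t") (auto simp: ennreal_neg)
  qed
  then have "(\<integral>\<^sup>+t. ennreal (g t) \<partial>M) = (\<integral>\<^sup>+t. (\<integral>\<^sup>+u. S t u \<partial>lborel) \<partial>M)" by simp
  also have "\<dots> = (\<integral>\<^sup>+u. (\<integral>\<^sup>+t. S t u \<partial>M) \<partial>lborel)"
    by (rule Fubini'[symmetric]) simp
  also have "\<dots> = (\<integral>\<^sup>+u. indicator {0..} u * emeasure M {t \<in> space M. u < g t} \<partial>lborel)"
  proof (rule nn_integral_cong)
    fix u :: real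
    have "(\<integral>\<^sup>+t. S t u \<partial>M)
        = (\<integral>\<^sup>+t. indicator {0..} u * indicator {t \<in> space M. u < g t} t \<partial>M)"
      by (intro nn_integral_cong) (auto simp: S_def indicator_def)
    then show "(\<integral>\<^sup>+t. S t u \<partial>M) = indicator {0..} u * emeasure M {t \<in> space M. u < g t}"
      by (simp add: nn_integral_cmult)
  qed
  finally show ?thesis .
qed

lemma stoch_le_nn_integral_mono:
  fixes P Q :: "real measure"
  assumes "stoch_le J P Q" "finite_measure P" "finite_measure Q"
    and sets_eq: "sets Q = sets P" and space: "space P = J"
    and meas: "\<And>t. t \<in> J \<Longrightarrow> {t..} \<inter> J \<in> sets P"
    and g: "g \<in> borel_measurable P" "mono_on J g"
  shows "(\<integral>\<^sup>+t. ennreal (g t) \<partial>P) \<le> (\<integral>\<^sup>+t. ennreal (g t) \<partial>Q)"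
proof -
  interpret P: finite_measure P by fact
  interpret Q: finite_measure Q by fact
  have space_Q: "space Q = J" using sets_eq_imp_space_eq[OF sets_eq] space by simp
  have gQ: "g \<in> borel_measurable Q" using g(1) sets_eq measurable_cong_sets by blast
  have "emeasure P ({t..} \<inter> J) \<le> emeasure Q ({t..} \<inter> J)" if "t \<in> J" for t
    using assms(1) that unfolding stoch_le_def P.emeasure_eq_measure Q.emeasure_eq_measure
    by (simp add: ennreal_leI)
  then have "emeasure P {t \<in> J. u < g t} \<le> emeasure Q {t \<in> J. u < g t}" for u
    using meas sets_eq
  proof (rule emeasure_up_closed_le)
    show "t \<in> {t \<in> J. u < g t}" if "s \<in> {t \<in> J. u < g t}" "t \<in> J" "s \<le> t" for s t
      using that mono_onD[OF g(2), of s t] by auto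
  qed auto
  then have "(\<integral>\<^sup>+u. indicator {0..} u * emeasure P {t \<in> space P. u < g t} \<partial>lborel)
      \<le> (\<integral>\<^sup>+u. indicator {0..} u * emeasure Q {t \<in> space Q. u < g t} \<partial>lborel)"
    unfolding space space_Q by (intro nn_integral_mono mult_left_mono) auto
  then show ?thesis
    unfolding nn_integral_layer_cake[OF P.sigma_finite_measure_axioms g(1)]
      nn_integral_layer_cake[OF Q.sigma_finite_measure_axioms gQ] .
qed

section \<open>Increments of the log-weights\<close>

text \<open>
  A form of the mean value theorem suited to derivatives that are one-sided at end points of
  \<open>\<Lambda>\<close>: only derivatives relative to \<open>\<Lambda>\<close> enter, also when they are restricted to \<open>{x..y}\<close>.
\<close>

lemma increment_le_if_vector_derivative_le:
  fixes f h :: "real \<Rightarrow> real"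
  assumes "is_interval \<Lambda>" "x \<in> \<Lambda>" "y \<in> \<Lambda>" "x \<le> y"
    and "\<And>l. l \<in> \<Lambda> \<Longrightarrow> f differentiable (at l within \<Lambda>)"
    and "\<And>l. l \<in> \<Lambda> \<Longrightarrow> h differentiable (at l within \<Lambda>)"
    and le: "\<And>l. l \<in> \<Lambda> \<Longrightarrow>
      vector_derivative f (at l within \<Lambda>) \<le> vector_derivative h (at l within \<Lambda>)"
  shows "f y - f x \<le> h y - h x"
proof -
  have sub: "{x..y} \<subseteq> \<Lambda>"
    using assms(1-3) by (meson atLeastAtMost_iff is_interval_1 subsetI)
  define k where "k l = h l - f l" for l
  define D where "D l = vector_derivative h (at l within \<Lambda>) - vector_derivative f (at l within \<Lambda>)" for l
  have deriv: "(k has_derivative (\<lambda>d. d * D l)) (at l within {x..y})" if "l \<in> {x..y}" for l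
  proof -
    have "(k has_vector_derivative D l) (at l within \<Lambda>)"
      unfolding k_def D_def using sub that assms(5,6)
      by (intro has_vector_derivative_diff) (auto simp: vector_derivative_works[symmetric])
    then show ?thesis
      using sub has_vector_derivative_within_subset
      unfolding has_vector_derivative_def by (simp add: has_derivative_subset)
  qed
  show ?thesis
  proof (cases "x = y")
    case False
    then have "x < y" using assms(4) by simp
    then obtain l where l: "l \<in> {x<..<y}" "k y - k x = (y - x) * D l"
      using mvt_simple[of x y k "\<lambda>l d. d * D l"] deriv by auto
    moreover have "l \<in> \<Lambda>" using sub l(1) by auto
    then have "0 \<le> D l" using le unfolding D_def by simp
    ultimately have "0 \<le> k y - k x"
      using \<open>x < y\<close> by simp
    then show ?thesis by (simp add: k_def)
  qed simp
qed

context weight_family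
begin

text \<open>
  This is used in two ways: with \<open>\<theta> = \<theta>'\<close> to see that the weight ratio is monotone in \<open>t\<close>, and
  with \<open>s = t\<close>, in both directions, to see that it does not depend on \<open>\<theta>\<close>.
\<close>

lemma log_increment_le:
  assumes "\<theta> \<in> \<Theta>" "\<theta>' \<in> \<Theta>" "s \<in> J" "t \<in> J" "x \<in> \<Lambda>" "y \<in> \<Lambda>" "x \<le> y"
    and "\<And>l. l \<in> \<Lambda> \<Longrightarrow> log_kernel \<Lambda> w \<theta> l s \<le> log_kernel \<Lambda> w \<theta>' l t"
  shows "ln (w y \<theta> s) - ln (w x \<theta> s) \<le> ln (w y \<theta>' t) - ln (w x \<theta>' t)"
  using assms increment_le_if_vector_derivative_le[of \<Lambda> x y "\<lambda>l. ln (w l \<theta> s)" "\<lambda>l. ln (w l \<theta>' t)"]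
    interval log_differentiable
  unfolding log_kernel_def by blast

lemma weight_ratio_le_iff:
  assumes "\<theta> \<in> \<Theta>" "\<theta>' \<in> \<Theta>" "s \<in> J" "t \<in> J" "x \<in> \<Lambda>" "y \<in> \<Lambda>"
  shows "w y \<theta> s / w x \<theta> s \<le> w y \<theta>' t / w x \<theta>' t \<longleftrightarrow>
    ln (w y \<theta> s) - ln (w x \<theta> s) \<le> ln (w y \<theta>' t) - ln (w x \<theta>' t)"
proof -
  have "0 < w y \<theta> s" "0 < w x \<theta> s" "0 < w y \<theta>' t" "0 < w x \<theta>' t"
    using assms positive by auto
  then show ?thesis by (simp flip: ln_divide_pos)
qed

section \<open>Change of parameter\<close>

lemma space_base: "space \<mu> = J"
  using base by auto

lemma half_line_sets: "{t..} \<inter> J \<in> sets \<mu>"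
proof (cases "is_interval J \<and> \<mu> = lebesgue_on J")
  case True
  then have "J \<in> sets lebesgue" using real_interval_borel_measurable by force
  then show ?thesis using True by (auto simp: sets_restrict_space)
qed (use base in auto)

lemma finite_measure_law:
  assumes "x \<in> \<Lambda>" "\<theta> \<in> \<Theta>"
  shows "finite_measure (law \<mu> w x \<theta>)"
proof
  note [measurable] = measurable[OF assms]
  have "emeasure (law \<mu> w x \<theta>) (space (law \<mu> w x \<theta>))
      = (\<integral>\<^sup>+t. ennreal (w x \<theta> t / Phi \<mu> w x \<theta>) \<partial>\<mu>)"
    unfolding law_def by (simp add: emeasure_density cong: nn_integral_cong)
  also have "\<dots> \<noteq> \<infinity>"
    using Phi_finite[OF assms] integrable_divide_zero[of "Phi \<mu> w x \<theta>" \<mu> "w x \<theta>"]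
    unfolding real_integrable_def by blast
  finally show "emeasure (law \<mu> w x \<theta>) (space (law \<mu> w x \<theta>)) \<noteq> \<infinity>" .
qed

text \<open>
  The law at \<open>y\<close> is, up to normalisation, the law at \<open>x\<close> reweighted by the ratio of the weights.
\<close>

lemma nn_integral_law_ratio:
  assumes "x \<in> \<Lambda>" "y \<in> \<Lambda>" "\<theta> \<in> \<Theta>"
  shows "(\<integral>\<^sup>+t. ennreal (w y \<theta> t / w x \<theta> t) \<partial>law \<mu> w x \<theta>)
    = ennreal (Phi \<mu> w y \<theta> / Phi \<mu> w x \<theta>)"
proof -
  note [measurable] = measurable[OF assms(1,3)] measurable[OF assms(2,3)]
  note pos = Phi_positive[OF assms(1,3)]
  have "(\<integral>\<^sup>+t. ennreal (w y \<theta> t / w x \<theta> t) \<partial>law \<mu> w x \<theta>)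
      = (\<integral>\<^sup>+t. ennreal (w x \<theta> t / Phi \<mu> w x \<theta>) * ennreal (w y \<theta> t / w x \<theta> t) \<partial>\<mu>)"
    unfolding law_def by (rule nn_integral_density) auto
  also have "\<dots> = (\<integral>\<^sup>+t. ennreal (w y \<theta> t / Phi \<mu> w x \<theta>) \<partial>\<mu>)"
  proof (rule nn_integral_cong)
    fix t assume "t \<in> space \<mu>"
    then have "0 < w x \<theta> t" "0 < w y \<theta> t" using positive assms space_base by auto
    then show "ennreal (w x \<theta> t / Phi \<mu> w x \<theta>) * ennreal (w y \<theta> t / w x \<theta> t)
        = ennreal (w y \<theta> t / Phi \<mu> w x \<theta>)"
      using pos by (simp flip: ennreal_mult add: field_simps)
  qed
  also have "\<dots> = ennreal (LINT t|\<mu>. w y \<theta> t / Phi \<mu> w x \<theta>)"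
    using Phi_finite[OF assms(2,3)] positive[OF assms(2,3)] pos space_base
    by (intro nn_integral_eq_integral AE_I2) (auto intro: less_imp_le)
  also have "\<dots> = ennreal (Phi \<mu> w y \<theta> / Phi \<mu> w x \<theta>)"
    by (simp add: Phi_def)
  finally show ?thesis .
qed

text \<open>
  The two expectations of \<open>nn_integral_law_ratio\<close> are compared by the stochastic order at \<open>x\<close>.
  The point \<open>y\<close> may lie on either side of \<open>x\<close>: forward steps serve a nondecreasing kernel,
  backward steps a nonincreasing one.
\<close>

lemma Phi_quotient_le:
  assumes "\<theta>1 \<in> \<Theta>" "\<theta>2 \<in> \<Theta>" "x \<in> \<Lambda>" "y \<in> \<Lambda>"
    and st: "stoch_le J (law \<mu> w x \<theta>2) (law \<mu> w x \<theta>1)"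
    and eq: "\<And>t. t \<in> J \<Longrightarrow> w y \<theta>1 t / w x \<theta>1 t = w y \<theta>2 t / w x \<theta>2 t"
    and mono: "mono_on J (\<lambda>t. w y \<theta>2 t / w x \<theta>2 t)"
  shows "Phi \<mu> w x \<theta>1 / Phi \<mu> w x \<theta>2 \<le> Phi \<mu> w y \<theta>1 / Phi \<mu> w y \<theta>2"
proof -
  note [measurable] = measurable[OF assms(3,2)] measurable[OF assms(4,2)]
  note pos = Phi_positive[OF assms(3,1)] Phi_positive[OF assms(3,2)]
    Phi_positive[OF assms(4,1)] Phi_positive[OF assms(4,2)]
  have "ennreal (Phi \<mu> w y \<theta>2 / Phi \<mu> w x \<theta>2)
      = (\<integral>\<^sup>+t. ennreal (w y \<theta>2 t / w x \<theta>2 t) \<partial>law \<mu> w x \<theta>2)"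
    using nn_integral_law_ratio assms by simp
  also have "\<dots> \<le> (\<integral>\<^sup>+t. ennreal (w y \<theta>2 t / w x \<theta>2 t) \<partial>law \<mu> w x \<theta>1)"
    using st finite_measure_law[OF assms(3,2)] finite_measure_law[OF assms(3,1)] mono
    by (intro stoch_le_nn_integral_mono[where J = J])
       (auto simp: law_def space_base half_line_sets)
  also have "\<dots> = (\<integral>\<^sup>+t. ennreal (w y \<theta>1 t / w x \<theta>1 t) \<partial>law \<mu> w x \<theta>1)"
    using eq by (intro nn_integral_cong) (simp add: law_def space_base)
  also have "\<dots> = ennreal (Phi \<mu> w y \<theta>1 / Phi \<mu> w x \<theta>1)"
    using nn_integral_law_ratio assms by simp
  finally have "Phi \<mu> w y \<theta>2 / Phi \<mu> w x \<theta>2 \<le> Phi \<mu> w y \<theta>1 / Phi \<mu> w x \<theta>1"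
    using pos by simp
  then show ?thesis using pos by (simp add: field_simps)
qed

end

section \<open>Monotonicity of the quotient\<close>

theorem theorem2p11:
  fixes \<Lambda> \<Theta> J :: "real set"
    and \<mu> :: "real measure"
    and w :: "real \<Rightarrow> real \<Rightarrow> real \<Rightarrow> real"
    and K :: "real \<Rightarrow> real \<Rightarrow> real"
    and \<theta>1 \<theta>2 :: real
  assumes "weight_family \<Lambda> \<Theta> J \<mu> w"
    and "\<theta>1 \<in> \<Theta>" and "\<theta>2 \<in> \<Theta>"
    and "\<forall>\<theta>\<in>\<Theta>. \<forall>x\<in>\<Lambda>. \<forall>t\<in>J. log_kernel \<Lambda> w \<theta> x t = K x t"
    and "\<forall>x\<in>\<Lambda>. stoch_le J (law \<mu> w x \<theta>2) (law \<mu> w x \<theta>1)"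
  shows "((\<forall>x\<in>\<Lambda>. mono_on J (K x)) \<longrightarrow>
            mono_on \<Lambda> (\<lambda>x. Phi \<mu> w x \<theta>1 / Phi \<mu> w x \<theta>2)) \<and>
         ((\<forall>x\<in>\<Lambda>. antimono_on J (K x)) \<longrightarrow>
            antimono_on \<Lambda> (\<lambda>x. Phi \<mu> w x \<theta>1 / Phi \<mu> w x \<theta>2))"
proof -
  interpret weight_family \<Lambda> \<Theta> J \<mu> w by fact
  have increment: "ln (w y \<theta> s) - ln (w x \<theta> s) \<le> ln (w y \<theta>' t) - ln (w x \<theta>' t)"
    if "\<theta> \<in> \<Theta>" "\<theta>' \<in> \<Theta>" "s \<in> J" "t \<in> J" "x \<in> \<Lambda>" "y \<in> \<Lambda>" "x \<le> y"
      "\<And>l. l \<in> \<Lambda> \<Longrightarrow> K l s \<le> K l t" for \<theta> \<theta>' s t x y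
    using that assms(4) by (intro log_increment_le) auto
  have ratio_eq: "w y \<theta>1 t / w x \<theta>1 t = w y \<theta>2 t / w x \<theta>2 t"
    if "t \<in> J" "x \<in> \<Lambda>" "y \<in> \<Lambda>" for t x y
  proof -
    have "ln (w y \<theta>1 t) - ln (w x \<theta>1 t) = ln (w y \<theta>2 t) - ln (w x \<theta>2 t)"
      using increment[of \<theta>1 \<theta>2 t t x y] increment[of \<theta>2 \<theta>1 t t x y]
        increment[of \<theta>1 \<theta>2 t t y x] increment[of \<theta>2 \<theta>1 t t y x] that assms(2,3)
      by (cases "x \<le> y") auto
    then show ?thesis
      using weight_ratio_le_iff that assms(2,3) by (intro antisym) auto
  qed
  have step: "Phi \<mu> w x \<theta>1 / Phi \<mu> w x \<theta>2 \<le> Phi \<mu> w y \<theta>1 / Phi \<mu> w y \<theta>2"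
    if "x \<in> \<Lambda>" "y \<in> \<Lambda>"
      and le: "\<And>s t. s \<in> J \<Longrightarrow> t \<in> J \<Longrightarrow> s \<le> t \<Longrightarrow>
        ln (w y \<theta>2 s) - ln (w x \<theta>2 s) \<le> ln (w y \<theta>2 t) - ln (w x \<theta>2 t)" for x y
  proof (rule Phi_quotient_le)
    show "mono_on J (\<lambda>t. w y \<theta>2 t / w x \<theta>2 t)"
      using le that(1,2) assms(3) weight_ratio_le_iff by (intro mono_onI) auto
  qed (use that assms ratio_eq in auto)
  show ?thesis
  proof (intro conjI impI)
    assume mono: "\<forall>x\<in>\<Lambda>. mono_on J (K x)"
    show "mono_on \<Lambda> (\<lambda>x. Phi \<mu> w x \<theta>1 / Phi \<mu> w x \<theta>2)"
    proof (rule mono_onI)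
      fix x y assume xy: "x \<in> \<Lambda>" "y \<in> \<Lambda>" "x \<le> y"
      show "Phi \<mu> w x \<theta>1 / Phi \<mu> w x \<theta>2 \<le> Phi \<mu> w y \<theta>1 / Phi \<mu> w y \<theta>2"
        using xy mono assms(3) by (intro step increment) (auto dest: mono_onD)
    qed
  next
    assume anti: "\<forall>x\<in>\<Lambda>. antimono_on J (K x)"
    show "antimono_on \<Lambda> (\<lambda>x. Phi \<mu> w x \<theta>1 / Phi \<mu> w x \<theta>2)"
    proof (rule monotone_onI)
      fix x y assume xy: "x \<in> \<Lambda>" "y \<in> \<Lambda>" "x \<le> y"
      show "Phi \<mu> w y \<theta>1 / Phi \<mu> w y \<theta>2 \<le> Phi \<mu> w x \<theta>1 / Phi \<mu> w x \<theta>2"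
      \<comment> \<open>a backward step, from \<open>y\<close> to \<open>x\<close>, whose weight ratio is nondecreasing in \<open>t\<close>\<close>
      proof (rule step)
        fix s t assume st: "s \<in> J" "t \<in> J" "s \<le> t"
        have "K l t \<le> K l s" if "l \<in> \<Lambda>" for l
          using anti that st by (auto dest: monotone_onD)
        then have "ln (w y \<theta>2 t) - ln (w x \<theta>2 t) \<le> ln (w y \<theta>2 s) - ln (w x \<theta>2 s)"
          using increment st xy assms(3) by blast
        then show "ln (w x \<theta>2 s) - ln (w y \<theta>2 s) \<le> ln (w x \<theta>2 t) - ln (w y \<theta>2 t)"
          by simp
      qed (use xy in auto)
    qed
  qed
qed

end
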